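(* Let $k\geq2$. The generating function $\sum_{n\geq0}d_nx^n$, where $d_n$ is the number of Dumont permutations of length $n$ that simultaneously avoid the patterns $132$, $123\cdots k$ and $2134\cdots k$, equals $G_{k-1}(x)+xG_{k-2}(x)$.
   Context: A permutation $\pi=\pi_1\cdots\pi_n\in S_n$ is a Dumont permutation (of the first kind) if every even entry $\pi_i$ is followed by a smaller entry ($i<n$ and $\pi_{i+1}<\pi_i$) and every odd entry $\pi_i$ is either last ($i=n$) or followed by a larger entry; the empty permutation is a Dumont permutation. $\pi$ avoids a (classical) pattern $\tau\in S_k$ if no subsequence of $\pi$ of length $k$ is order-isomorphic to $\tau$. $123\cdots k$ is the identity of $[k]$ and $2134\cdots k$ is the permutation of $[k]$ starting $2,1$ followed by $3,\dots,k$. The functions $G_r$ are defined by $G_0(x)=G_1(x)=1$ and $G_r(x)=1+\frac{x^2G_{r-1}(x)}{1-x^2G_{r-2}(x)}$ for $r\geq2$. *)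

theory Defs
  imports
    "HOL-Library.Sublist"
    "HOL-Combinatorics.Multiset_Permutations"
    "HOL-Computational_Algebra.Formal_Power_Series"
begin

text \<open>
  A permutation of $[n]$ is its word: an element of \<^term>\<open>permutations_of_set {1..n::nat}\<close>.
  List positions count from 0, so entry $\pi_i$ of the word is \<open>\<pi> ! (i - 1)\<close>.
\<close>

definition dumont :: "nat list \<Rightarrow> bool" where
  "dumont \<pi> \<longleftrightarrow> (\<forall>i < length \<pi>.
     (even (\<pi> ! i) \<longrightarrow> Suc i < length \<pi> \<and> \<pi> ! Suc i < \<pi> ! i) \<and>
     (odd (\<pi> ! i) \<longrightarrow> Suc i = length \<pi> \<or> \<pi> ! i < \<pi> ! Suc i))"

definition order_isomorphic :: "nat list \<Rightarrow> nat list \<Rightarrow> bool" where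
  "order_isomorphic xs ys \<longleftrightarrow> length xs = length ys \<and>
     (\<forall>i < length xs. \<forall>j < length xs. xs ! i < xs ! j \<longleftrightarrow> ys ! i < ys ! j)"

definition avoids :: "nat list \<Rightarrow> nat list \<Rightarrow> bool" where
  "avoids \<pi> \<tau> \<longleftrightarrow> \<not> (\<exists>\<sigma>. subseq \<sigma> \<pi> \<and> order_isomorphic \<sigma> \<tau>)"

text \<open>
  The denominators have constant coefficient 1, so the division is by a unit of the ring of
  formal power series.
\<close>

fun G :: "nat \<Rightarrow> rat fps" where
  "G 0 = 1"
| "G (Suc 0) = 1"
| "G (Suc (Suc r)) = 1 + fps_X ^ 2 * G (Suc r) / (1 - fps_X ^ 2 * G r)"

end

theory Submission
  imports Defs "HOL-Computational_Algebra.Formal_Laurent_Series"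
begin

text \<open>
  Split a $132$-avoiding permutation of $[n]$ at its maximum as $\alpha\, n\, \beta$; every entry of
  $\alpha$ exceeds every entry of $\beta$. If the permutation is Dumont and $n$ is odd, then $n$ comes
  last, so $\beta$ is empty. If $n$ is even, $\beta$ is a nonempty Dumont permutation of some $[j]$,
  and either $\alpha$ is empty or $j$ is even, since an odd $j$ would make the least entry $j + 1$ of
  $\alpha$ even although no smaller entry can follow it there. Appending the maximum lengthens each
  pattern that ends in its maximum by one, while no occurrence of a pattern whose first entry is below
  its last one meets both $\alpha\, n$ and $\beta$. Hence, with $k = r + 1$, the series
  $E_r(x) = \sum_m d_{2m} x^m$ satisfies $E_{r+2} - 1 = x E_{r+1} + x E_r (E_{r+2} - 1)$, so that
  $G_r(x) = E_r(x^2)$, and the odd lengths contribute $x E_{r-1}(x^2)$.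
\<close>

subsection \<open>Pattern avoidance\<close>

lemma set_mono_subseq: "subseq xs ys \<Longrightarrow> set xs \<subseteq> set ys"
  by (auto dest: list_emb_set)

lemma subseq_snoc_iff:
  "subseq zs (xs @ [x]) \<longleftrightarrow> subseq zs xs \<or> (\<exists>ws. zs = ws @ [x] \<and> subseq ws xs)"
proof -
  have "subseq vs [x] \<longleftrightarrow> vs = [] \<or> vs = [x]" for vs
    by (cases vs) (auto split: if_splits)
  then show ?thesis by (auto simp: subseq_append_iff)
qed

lemma subseq_map_iff: "subseq zs (map f xs) \<longleftrightarrow> (\<exists>ws. zs = map f ws \<and> subseq ws xs)"
  by (auto simp: subseq_conv_nths nths_map)

lemma avoidsI:
  "(\<And>\<sigma>. subseq \<sigma> \<pi> \<Longrightarrow> order_isomorphic \<sigma> \<tau> \<Longrightarrow> False) \<Longrightarrow> avoids \<pi> \<tau>"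
  by (auto simp: avoids_def)

lemma avoidsD: "avoids \<pi> \<tau> \<Longrightarrow> subseq \<sigma> \<pi> \<Longrightarrow> \<not> order_isomorphic \<sigma> \<tau>"
  by (auto simp: avoids_def)

lemma avoids_subseq: "avoids \<pi> \<tau> \<Longrightarrow> subseq \<rho> \<pi> \<Longrightarrow> avoids \<rho> \<tau>"
  by (meson avoidsI avoidsD subseq_order.trans)

lemma avoids_Nil_iff [simp]: "avoids [] \<tau> \<longleftrightarrow> \<tau> \<noteq> []"
  by (auto simp: avoids_def order_isomorphic_def)

lemma avoids_singleton_iff: "avoids \<pi> [a] \<longleftrightarrow> \<pi> = []"
proof
  assume "avoids \<pi> [a]"
  moreover have "order_isomorphic [x] [a]" for x by (simp add: order_isomorphic_def)
  ultimately show "\<pi> = []" by (cases \<pi>) (auto dest: avoidsD)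
qed simp

lemma order_isomorphic_lengthD: "order_isomorphic xs ys \<Longrightarrow> length xs = length ys"
  by (simp add: order_isomorphic_def)

lemma order_isomorphic_nth_less_iff:
  assumes "order_isomorphic xs ys" "i < length ys" "j < length ys"
  shows "xs ! i < xs ! j \<longleftrightarrow> ys ! i < ys ! j"
  using assms by (simp add: order_isomorphic_def)

lemma order_isomorphic_hd_less_last:
  assumes "order_isomorphic xs ys" "ys \<noteq> []" "hd ys < last ys"
  shows "hd xs < last xs"
proof -
  have "length xs = length ys" using assms(1) by (rule order_isomorphic_lengthD)
  then have "xs \<noteq> []" using assms(2) by auto
  with assms \<open>length xs = length ys\<close> show ?thesis
    using order_isomorphic_nth_less_iff[OF assms(1), of 0 "length ys - 1"]
    by (simp add: hd_conv_nth last_conv_nth)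
qed

lemma order_isomorphic_snocD: "order_isomorphic (xs @ [x]) (ys @ [y]) \<Longrightarrow> order_isomorphic xs ys"
  by (auto simp: order_isomorphic_def nth_append All_less_Suc)

lemma order_isomorphic_snoc_max:
  assumes "order_isomorphic xs ys" "\<forall>x\<in>set xs. x < n" "\<forall>y\<in>set ys. y < m"
  shows "order_isomorphic (xs @ [n]) (ys @ [m])"
  using assms
  by (auto simp: order_isomorphic_def nth_append All_less_Suc all_set_conv_all_nth
      not_less less_imp_le)

lemma order_isomorphic_map_strict_mono_iff:
  fixes f :: "nat \<Rightarrow> nat"
  assumes "strict_mono f"
  shows "order_isomorphic (map f xs) ys \<longleftrightarrow> order_isomorphic xs ys"
  using assms by (auto simp: order_isomorphic_def strict_mono_less)

lemma avoids_map_strict_mono_iff: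
  fixes f :: "nat \<Rightarrow> nat"
  assumes "strict_mono f"
  shows "avoids (map f \<pi>) \<tau> \<longleftrightarrow> avoids \<pi> \<tau>"
  using order_isomorphic_map_strict_mono_iff[OF assms]
  by (auto simp: avoids_def subseq_map_iff)

lemma avoids_snoc_max_iff:
  assumes \<pi>: "\<forall>x\<in>set \<pi>. x < n" and \<tau>: "\<forall>t\<in>set \<tau>. t < m"
  shows "avoids (\<pi> @ [n]) (\<tau> @ [m]) \<longleftrightarrow> avoids \<pi> \<tau>"
proof
  assume avoids: "avoids (\<pi> @ [n]) (\<tau> @ [m])"
  show "avoids \<pi> \<tau>"
  proof (rule avoidsI)
    fix \<sigma> assume \<sigma>: "subseq \<sigma> \<pi>" "order_isomorphic \<sigma> \<tau>"
    then have "order_isomorphic (\<sigma> @ [n]) (\<tau> @ [m])"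
      using \<pi> \<tau> by (intro order_isomorphic_snoc_max) (auto dest: set_mono_subseq)
    moreover have "subseq (\<sigma> @ [n]) (\<pi> @ [n])" using \<sigma>(1) by simp
    ultimately show False using avoids avoidsD by blast
  qed
next
  assume avoids: "avoids \<pi> \<tau>"
  show "avoids (\<pi> @ [n]) (\<tau> @ [m])"
  proof (rule avoidsI)
    fix \<sigma> assume \<sigma>: "subseq \<sigma> (\<pi> @ [n])" "order_isomorphic \<sigma> (\<tau> @ [m])"
    from \<sigma>(2) obtain \<rho> x where \<rho>: "\<sigma> = \<rho> @ [x]"
      by (cases \<sigma> rule: rev_cases) (auto dest: order_isomorphic_lengthD)
    have "order_isomorphic \<rho> \<tau>" using \<sigma>(2) \<rho> order_isomorphic_snocD by blast
    moreover have "subseq \<rho> \<pi>"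
      using \<sigma>(1) \<rho> by (auto simp: subseq_snoc_iff intro: subseq_order.trans)
    ultimately show False using avoids avoidsD by blast
  qed
qed

lemma avoids_snoc_max_iff_if_last_less:
  assumes \<pi>: "\<forall>x\<in>set \<pi>. x < n" and \<tau>: "t \<in> set \<tau>" "last \<tau> < t"
  shows "avoids (\<pi> @ [n]) \<tau> \<longleftrightarrow> avoids \<pi> \<tau>"
proof
  assume avoids: "avoids \<pi> \<tau>"
  show "avoids (\<pi> @ [n]) \<tau>"
  proof (rule avoidsI)
    fix \<sigma> assume \<sigma>: "subseq \<sigma> (\<pi> @ [n])" "order_isomorphic \<sigma> \<tau>"
    have length_eq: "length \<sigma> = length \<tau>" using \<sigma>(2) by (rule order_isomorphic_lengthD)
    from \<tau>(1) obtain i where i: "i < length \<tau>" "t = \<tau> ! i" by (metis in_set_conv_nth)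
    then have "\<tau> \<noteq> []" "\<sigma> \<noteq> []" using length_eq by auto
    then have last_less: "last \<sigma> < \<sigma> ! i"
      using order_isomorphic_nth_less_iff[OF \<sigma>(2), of "length \<tau> - 1" i] i \<tau>(2) length_eq
      by (simp add: last_conv_nth)
    have "\<sigma> ! i \<in> set (\<pi> @ [n])"
      using set_mono_subseq[OF \<sigma>(1)] nth_mem[of i \<sigma>] i(1) length_eq by (metis subsetD)
    then have "\<sigma> ! i \<le> n" using \<pi> by auto
    with last_less have "last \<sigma> \<noteq> n" by simp
    then have "subseq \<sigma> \<pi>" using \<sigma>(1) by (auto simp: subseq_snoc_iff)
    then show False using avoids \<sigma>(2) avoidsD by blast
  qed
qed (auto elim: avoids_subseq)

lemma avoids_append_iff_if_hd_less_last:
  assumes \<pi>\<rho>: "\<forall>x\<in>set \<pi>. \<forall>y\<in>set \<rho>. y < x" and \<tau>: "\<tau> \<noteq> []" "hd \<tau> < last \<tau>"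
  shows "avoids (\<pi> @ \<rho>) \<tau> \<longleftrightarrow> avoids \<pi> \<tau> \<and> avoids \<rho> \<tau>"
proof
  assume avoids: "avoids \<pi> \<tau> \<and> avoids \<rho> \<tau>"
  show "avoids (\<pi> @ \<rho>) \<tau>"
  proof (rule avoidsI)
    fix \<sigma> assume \<sigma>: "subseq \<sigma> (\<pi> @ \<rho>)" "order_isomorphic \<sigma> \<tau>"
    then obtain us vs where parts: "\<sigma> = us @ vs" "subseq us \<pi>" "subseq vs \<rho>"
      by (auto simp: subseq_append_iff)
    have hd_less_last: "hd \<sigma> < last \<sigma>" using \<sigma>(2) \<tau> by (rule order_isomorphic_hd_less_last)
    have "us = [] \<or> vs = []"
    proof (rule ccontr)
      assume "\<not> (us = [] \<or> vs = [])"
      then have "hd \<sigma> \<in> set \<pi>" "last \<sigma> \<in> set \<rho>"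
        using parts(1) set_mono_subseq[OF parts(2)] set_mono_subseq[OF parts(3)]
          hd_in_set[of us] last_in_set[of vs] by auto
      then show False using \<pi>\<rho> hd_less_last by (meson less_asym)
    qed
    then show False using avoids parts \<sigma>(2) avoidsD by auto
  qed
qed (auto elim: avoids_subseq)

lemma avoids_132_max_imp_less:
  assumes "avoids (\<pi> @ n # \<rho>) [1, 3, 2]" "distinct (\<pi> @ \<rho>)" "\<forall>y\<in>set \<rho>. y < n"
    and x: "x \<in> set \<pi>" and y: "y \<in> set \<rho>"
  shows "y < x"
proof (rule ccontr)
  assume "\<not> y < x"
  moreover have "x \<noteq> y" using assms(2) x y by auto
  ultimately have "x < y" "y < n" using assms(3) y by auto
  then have "order_isomorphic [x, n, y] [1, 3, 2]"
    by (auto simp: order_isomorphic_def All_less_Suc2)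
  moreover have "subseq ([x] @ [n, y]) (\<pi> @ n # \<rho>)"
    using x y by (intro list_emb_append_mono) (auto simp: subseq_singleton_left)
  ultimately show False using assms(1) avoidsD by auto
qed

text \<open>
  The last two patterns are those of length $r + 1$, so that $r$ is the index in $G_r$. For
  $r = 0$ they are $1$ and $21$, which only the empty word avoids.
\<close>

definition restricted :: "nat \<Rightarrow> nat list \<Rightarrow> bool" where
  "restricted r \<pi> \<longleftrightarrow>
     avoids \<pi> [1, 3, 2] \<and> avoids \<pi> [1..<r + 2] \<and> avoids \<pi> ([2, 1] @ [3..<r + 2])"

lemma restricted_Nil [simp]: "restricted r []"
  by (simp add: restricted_def)

lemma restricted_0_iff: "restricted 0 \<pi> \<longleftrightarrow> \<pi> = []"
  by (auto simp: restricted_def numeral_2_eq_2 avoids_singleton_iff)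

lemma restricted_1_length_le:
  assumes "restricted 1 \<pi>" "distinct \<pi>"
  shows "length \<pi> \<le> 1"
proof (rule ccontr)
  assume "\<not> length \<pi> \<le> 1"
  then obtain a b \<rho> where \<pi>: "\<pi> = a # b # \<rho>"
    by (cases \<pi> rule: remdups_adj.cases) auto
  then consider "a < b" | "b < a" using assms(2) by fastforce
  then have "order_isomorphic [a, b] [1, 2] \<or> order_isomorphic [a, b] [2, 1]"
    by cases (auto simp: order_isomorphic_def All_less_Suc2)
  moreover have "avoids \<pi> [1, 2]" "avoids \<pi> [2, 1]"
    using assms(1) by (simp_all add: restricted_def numeral_2_eq_2)
  moreover have "subseq [a, b] \<pi>" using \<pi> by simp
  ultimately show False using avoidsD by blast
qed

lemma restricted_map_strict_mono_iff:
  "strict_mono f \<Longrightarrow> restricted r (map f \<pi>) \<longleftrightarrow> restricted r \<pi>"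
  by (simp add: restricted_def avoids_map_strict_mono_iff)

lemma restricted_snoc_max_iff:
  assumes \<pi>: "\<forall>x\<in>set \<pi>. x < n"
  shows "restricted (Suc r) (\<pi> @ [n]) \<longleftrightarrow> restricted r \<pi>"
proof -
  have upt_snoc: "[a..<Suc r + 2] = [a..<r + 2] @ [r + 2]" if "a \<le> r + 2" for a using that by simp
  have "avoids (\<pi> @ [n]) [1, 3, 2] \<longleftrightarrow> avoids \<pi> [1, 3, 2]"
    using avoids_snoc_max_iff_if_last_less[OF \<pi>, of 3] by simp
  moreover have "avoids (\<pi> @ [n]) [1..<Suc r + 2] \<longleftrightarrow> avoids \<pi> [1..<r + 2]"
    using avoids_snoc_max_iff[OF \<pi>, of "[1..<r + 2]" "r + 2"] upt_snoc[of 1] by auto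
  moreover have "avoids (\<pi> @ [n]) ([2, 1] @ [3..<Suc r + 2]) \<longleftrightarrow> avoids \<pi> ([2, 1] @ [3..<r + 2])"
  proof (cases "r = 0")
    case True
    then show ?thesis using avoids_snoc_max_iff_if_last_less[OF \<pi>, of 2 "[2, 1]"] by simp
  next
    case False
    then have "[2, 1] @ [3..<Suc r + 2] = ([2, 1] @ [3..<r + 2]) @ [r + 2]"
      using upt_snoc[of 3] by simp
    then show ?thesis
      using avoids_snoc_max_iff[OF \<pi>, of "[2, 1] @ [3..<r + 2]" "r + 2"] False by auto
  qed
  ultimately show ?thesis by (simp only: restricted_def)
qed

lemma restricted_append_iff:
  assumes "\<forall>x\<in>set \<pi>. \<forall>y\<in>set \<rho>. y < x"
  shows "restricted (Suc (Suc r)) (\<pi> @ \<rho>) \<longleftrightarrow>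
    restricted (Suc (Suc r)) \<pi> \<and> restricted (Suc (Suc r)) \<rho>"
proof -
  have "hd \<tau> < last \<tau>"
    if "\<tau> \<in> {[1, 3, 2], [1..<Suc (Suc r) + 2], [2, 1] @ [3..<Suc (Suc r) + 2]}" for \<tau> :: "nat list"
    using that by (auto simp del: upt_Suc)
  then show ?thesis
    by (simp add: restricted_def avoids_append_iff_if_hd_less_last[OF assms] del: upt_Suc) blast
qed

subsection \<open>Decomposition at the maximum\<close>

definition perms :: "nat \<Rightarrow> nat list set" where
  "perms n = permutations_of_set {1..n}"

lemma permsI: "set \<pi> = {1..n} \<Longrightarrow> distinct \<pi> \<Longrightarrow> \<pi> \<in> perms n"
  by (auto simp: perms_def)

lemma permsD:
  assumes "\<pi> \<in> perms n"
  shows "set \<pi> = {1..n}" "distinct \<pi>" "length \<pi> = n"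
  using assms length_finite_permutations_of_set[of \<pi> "{1..n}"]
  by (auto simp: perms_def permutations_of_set_def)

lemma perms_0 [simp]: "perms 0 = {[]}"
  by (simp add: perms_def)

lemma finite_perms [simp]: "finite (perms n)"
  by (simp add: perms_def)

definition graft :: "nat list \<Rightarrow> nat list \<Rightarrow> nat list" where
  "graft \<alpha> \<beta> = map ((+) (length \<beta>)) \<alpha> @ Suc (length \<alpha> + length \<beta>) # \<beta>"

lemma graft_Nil_right: "graft \<alpha> [] = \<alpha> @ [Suc (length \<alpha>)]"
  by (simp add: graft_def map_idI)

lemma perms_shift_bounds:
  assumes "\<alpha> \<in> perms i" "\<beta> \<in> perms j"
  shows "\<forall>x\<in>set (map ((+) (length \<beta>)) \<alpha>). x < Suc (length \<alpha> + length \<beta>)"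
    and "\<forall>y\<in>set \<beta>. y < Suc (length \<alpha> + length \<beta>)"
    and "\<forall>x\<in>set (map ((+) (length \<beta>)) \<alpha>). \<forall>y\<in>set \<beta>. y < x"
  using permsD(1,3)[OF assms(1)] permsD(1,3)[OF assms(2)] by auto

lemma graft_in_perms:
  assumes "\<alpha> \<in> perms i" "\<beta> \<in> perms j"
  shows "graft \<alpha> \<beta> \<in> perms (Suc (i + j))"
proof (rule permsI)
  have \<alpha>: "set \<alpha> = {1..i}" "distinct \<alpha>" "length \<alpha> = i"
    and \<beta>: "set \<beta> = {1..j}" "distinct \<beta>" "length \<beta> = j"
    using assms permsD by blast+
  have "set (graft \<alpha> \<beta>) = (+) j ` {1..i} \<union> insert (Suc (i + j)) {1..j}"
    using \<alpha> \<beta> by (simp add: graft_def)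
  also have "\<dots> = {1..Suc (i + j)}" by auto
  finally show "set (graft \<alpha> \<beta>) = {1..Suc (i + j)}" .
  show "distinct (graft \<alpha> \<beta>)"
    using \<alpha> \<beta> by (auto simp: graft_def distinct_map)
qed

lemma graft_eq_iff:
  assumes "\<alpha> \<in> perms i" "\<beta> \<in> perms j" "\<alpha>' \<in> perms i'" "\<beta>' \<in> perms j'"
  shows "graft \<alpha> \<beta> = graft \<alpha>' \<beta>' \<longleftrightarrow> \<alpha> = \<alpha>' \<and> \<beta> = \<beta>'"
proof
  assume eq: "graft \<alpha> \<beta> = graft \<alpha>' \<beta>'"
  then have "length (graft \<alpha> \<beta>) = length (graft \<alpha>' \<beta>')" by simp
  then have length_sum: "length \<alpha>' + length \<beta>' = length \<alpha> + length \<beta>" by (simp add: graft_def)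
  have "Suc (length \<alpha> + length \<beta>) \<notin> set (map ((+) (length \<beta>)) \<alpha>)"
    "Suc (length \<alpha> + length \<beta>) \<notin> set \<beta>"
    using perms_shift_bounds(1,2)[OF assms(1,2)] by blast+
  then have "map ((+) (length \<beta>)) \<alpha> = map ((+) (length \<beta>')) \<alpha>' \<and> \<beta> = \<beta>'"
    using eq unfolding graft_def length_sum by (rule append_Cons_eq_iff[THEN iffD1])
  then show "\<alpha> = \<alpha>' \<and> \<beta> = \<beta>'" by auto
qed simp

lemma atLeastAtMost_split_if_less:
  fixes A B :: "nat set"
  assumes union: "A \<union> B = {1..m}" and A_less_B: "\<And>a b. a \<in> A \<Longrightarrow> b \<in> B \<Longrightarrow> a < b"
  obtains j where "j \<le> m" "A = {1..j}" "B = {j<..m}"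
proof
  define j where "j = Max (insert 0 A)"
  have "finite A" using union by (metis finite_Un finite_atLeastAtMost)
  then have j_cases: "j = 0 \<or> j \<in> A" using Max_in[of "insert 0 A"] by (auto simp: j_def)
  have A_le: "a \<le> j" if "a \<in> A" for a using that \<open>finite A\<close> by (simp add: j_def)
  have B_greater: "j < b" if "b \<in> B" for b
  proof -
    have "b \<in> {1..m}" using that union by blast
    then show ?thesis using j_cases A_less_B[OF _ that] by auto
  qed
  show "j \<le> m" using j_cases union by auto
  then show "A = {1..j}" using A_le B_greater union by fastforce
  show "B = {j<..m}" using A_le B_greater union by fastforce
qed

lemma avoids_132_graftE:
  assumes \<pi>: "\<pi> \<in> perms (Suc m)" and avoids: "avoids \<pi> [1, 3, 2]"
  obtains \<alpha> \<beta> j where "j \<le> m" "\<alpha> \<in> perms (m - j)" "\<beta> \<in> perms j" "\<pi> = graft \<alpha> \<beta>"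
proof -
  have "Suc m \<in> set \<pi>" using permsD(1)[OF \<pi>] by simp
  then obtain \<gamma> \<beta> where split: "\<pi> = \<gamma> @ Suc m # \<beta>" by (auto simp: in_set_conv_decomp)
  have distinct_parts: "distinct (\<gamma> @ Suc m # \<beta>)" using permsD(2)[OF \<pi>] split by simp
  then have "set \<beta> \<union> set \<gamma> = set \<pi> - {Suc m}" using split by auto
  also have "\<dots> = {1..m}" using permsD(1)[OF \<pi>] by auto
  finally have union: "set \<beta> \<union> set \<gamma> = {1..m}" .
  have \<beta>_less_\<gamma>: "y < x" if "y \<in> set \<beta>" "x \<in> set \<gamma>" for x y
  proof (rule avoids_132_max_imp_less)
    show "avoids (\<gamma> @ Suc m # \<beta>) [1, 3, 2]" using avoids split by simp
    show "\<forall>y\<in>set \<beta>. y < Suc m" using union by (auto simp: less_Suc_eq_le)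
  qed (use distinct_parts that in auto)
  obtain j where j: "j \<le> m" "set \<beta> = {1..j}" "set \<gamma> = {j<..m}"
    using atLeastAtMost_split_if_less[OF union \<beta>_less_\<gamma>] .
  have \<beta>: "\<beta> \<in> perms j" using j(2) distinct_parts by (intro permsI) auto
  have "{j<..m} = (+) j ` {1..m - j}" using j(1) by auto
  then have "\<gamma> \<in> permutations_of_set ((+) j ` {1..m - j})" using j(3) distinct_parts by auto
  then have "\<gamma> \<in> map ((+) j) ` perms (m - j)"
    by (simp only: perms_def permutations_of_set_image_inj inj_on_add)
  then obtain \<alpha> where \<alpha>: "\<alpha> \<in> perms (m - j)" "\<gamma> = map ((+) j) \<alpha>" by blast
  then have "\<pi> = graft \<alpha> \<beta>"
    using j(1) split permsD(3)[OF \<beta>] permsD(3)[OF \<alpha>(1)] by (simp add: graft_def)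
  then show thesis using that j(1) \<alpha>(1) \<beta> by blast
qed

lemma card_eq_sum_grafts:
  assumes S: "S \<subseteq> {\<pi> \<in> perms (Suc m). avoids \<pi> [1, 3, 2]}"
  shows "card S = (\<Sum>j\<le>m. card {(\<alpha>, \<beta>) \<in> perms (m - j) \<times> perms j. graft \<alpha> \<beta> \<in> S})"
proof -
  define pairs where "pairs j = {(\<alpha>, \<beta>) \<in> perms (m - j) \<times> perms j. graft \<alpha> \<beta> \<in> S}" for j
  have "S = (\<lambda>(\<alpha>, \<beta>). graft \<alpha> \<beta>) ` (\<Union>j\<le>m. pairs j)"
  proof (intro equalityI subsetI)
    fix \<pi> assume \<pi>: "\<pi> \<in> S"
    then have "\<pi> \<in> perms (Suc m)" "avoids \<pi> [1, 3, 2]" using S by auto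
    then obtain \<alpha> \<beta> j where "j \<le> m" "(\<alpha>, \<beta>) \<in> pairs j" "\<pi> = graft \<alpha> \<beta>"
      using avoids_132_graftE \<pi> unfolding pairs_def by blast
    then show "\<pi> \<in> (\<lambda>(\<alpha>, \<beta>). graft \<alpha> \<beta>) ` (\<Union>j\<le>m. pairs j)" by force
  qed (auto simp: pairs_def)
  moreover have "inj_on (\<lambda>(\<alpha>, \<beta>). graft \<alpha> \<beta>) (\<Union>j\<le>m. pairs j)"
    by (rule inj_onI) (auto simp: pairs_def graft_eq_iff)
  ultimately have "card S = card (\<Union>j\<le>m. pairs j)" by (metis card_image)
  also have "\<dots> = (\<Sum>j\<le>m. card (pairs j))"
  proof (rule card_UN_disjoint)
    have "finite (pairs j)" for j
      by (rule finite_subset[of _ "perms (m - j) \<times> perms j"]) (auto simp: pairs_def)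
    then show "\<forall>j\<in>{..m}. finite (pairs j)" by blast
    show "\<forall>j\<in>{..m}. \<forall>j'\<in>{..m}. j \<noteq> j' \<longrightarrow> pairs j \<inter> pairs j' = {}"
      by (auto simp: pairs_def dest: permsD(3))
  qed simp
  finally show ?thesis unfolding pairs_def .
qed

lemma restricted_graft_iff:
  assumes "\<alpha> \<in> perms i" "\<beta> \<in> perms j"
  shows "restricted (Suc (Suc r)) (graft \<alpha> \<beta>) \<longleftrightarrow>
    restricted (Suc r) \<alpha> \<and> restricted (Suc (Suc r)) \<beta>"
proof -
  let ?\<alpha> = "map ((+) (length \<beta>)) \<alpha>" and ?n = "Suc (length \<alpha> + length \<beta>)"
  note bounds = perms_shift_bounds[OF assms]
  have "restricted (Suc (Suc r)) ((?\<alpha> @ [?n]) @ \<beta>) \<longleftrightarrow>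
      restricted (Suc (Suc r)) (?\<alpha> @ [?n]) \<and> restricted (Suc (Suc r)) \<beta>"
    using bounds(2,3) by (intro restricted_append_iff) auto
  also have "restricted (Suc (Suc r)) (?\<alpha> @ [?n]) \<longleftrightarrow> restricted (Suc r) ?\<alpha>"
    using bounds(1) by (rule restricted_snoc_max_iff)
  also have "\<dots> \<longleftrightarrow> restricted (Suc r) \<alpha>"
    by (rule restricted_map_strict_mono_iff) (simp add: strict_mono_def)
  finally show ?thesis by (simp add: graft_def)
qed

lemma restricted_graft_Nil_iff:
  assumes "\<alpha> \<in> perms i"
  shows "restricted (Suc r) (graft \<alpha> []) \<longleftrightarrow> restricted r \<alpha>"
  unfolding graft_Nil_right
  by (rule restricted_snoc_max_iff) (use perms_shift_bounds(1)[OF assms, of "[]" 0] in simp)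

subsection \<open>Dumont permutations\<close>

definition dumont_step :: "nat \<Rightarrow> nat \<Rightarrow> bool" where
  "dumont_step a b \<longleftrightarrow> (if even a then b < a else a < b)"

lemma dumont_iff_successively:
  "dumont \<pi> \<longleftrightarrow> successively dumont_step \<pi> \<and> (\<pi> \<noteq> [] \<longrightarrow> odd (last \<pi>))"
proof (cases "\<pi> = []")
  case False
  then obtain m where "length \<pi> = Suc m" by (cases \<pi>) auto
  moreover from this have "last \<pi> = \<pi> ! m" using False by (simp add: last_conv_nth)
  ultimately show ?thesis
    unfolding dumont_def successively_conv_nth dumont_step_def
    by (auto simp: All_less_Suc)
qed (simp add: dumont_def)

lemma dumont_Nil [simp]: "dumont []"
  by (simp add: dumont_def)

lemma dumont_append_Cons_max_iff:
  assumes "\<forall>x\<in>set \<pi>. x < n" "\<forall>y\<in>set \<rho>. y < n"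
  shows "dumont (\<pi> @ n # \<rho>) \<longleftrightarrow>
    dumont \<pi> \<and> (if even n then \<rho> \<noteq> [] \<and> dumont \<rho> else \<rho> = [])"
proof -
  have "\<rho> \<noteq> [] \<Longrightarrow> hd \<rho> < n" using assms(2) by simp
  then have "\<rho> \<noteq> [] \<Longrightarrow> dumont_step n (hd \<rho>) \<longleftrightarrow> even n" by (auto simp: dumont_step_def)
  moreover have "\<pi> \<noteq> [] \<Longrightarrow> dumont_step (last \<pi>) n \<longleftrightarrow> odd (last \<pi>)"
    using assms(1) last_in_set[of \<pi>] by (auto simp: dumont_step_def not_less less_imp_le)
  ultimately show ?thesis
    by (auto simp: dumont_iff_successively successively_append_iff successively_Cons)
qed

lemma dumont_even_not_minimal:
  assumes "dumont \<pi>" "x \<in> set \<pi>" "even x"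
  shows "\<exists>y\<in>set \<pi>. y < x"
  using assms unfolding dumont_def by (metis in_set_conv_nth)

lemma dumont_map_add_even_iff:
  "even j \<Longrightarrow> dumont (map ((+) j) \<pi>) \<longleftrightarrow> dumont \<pi>"
  by (simp add: dumont_iff_successively successively_map dumont_step_def last_map)

lemma dumont_map_add_iff:
  assumes "\<pi> \<in> perms i"
  shows "dumont (map ((+) j) \<pi>) \<longleftrightarrow> i = 0 \<or> even j \<and> dumont \<pi>"
proof (cases "even j \<or> i = 0")
  case True
  then show ?thesis using assms by (auto simp: dumont_map_add_even_iff)
next
  case False
  then have set_shift: "set (map ((+) j) \<pi>) = {Suc j..i + j}"
    using permsD(1)[OF assms] by (simp add: add.commute)
  have "\<not> dumont (map ((+) j) \<pi>)"
  proof
    assume "dumont (map ((+) j) \<pi>)"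
    then show False using dumont_even_not_minimal[of _ "Suc j"] set_shift False by fastforce
  qed
  then show ?thesis using False by simp
qed

lemma dumont_graft_iff:
  assumes "\<alpha> \<in> perms i" "\<beta> \<in> perms j"
  shows "dumont (graft \<alpha> \<beta>) \<longleftrightarrow>
    (if even (i + j) then j = 0 \<and> dumont \<alpha>
     else (i = 0 \<or> even j \<and> 0 < j \<and> dumont \<alpha>) \<and> dumont \<beta>)"
proof -
  have lengths: "length \<alpha> = i" "length \<beta> = j" using assms by (simp_all only: permsD(3))
  then have "\<beta> = [] \<longleftrightarrow> j = 0" by auto
  then show ?thesis
    using dumont_append_Cons_max_iff[OF perms_shift_bounds(1,2)[OF assms]]
      dumont_map_add_iff[OF assms(1), of j]
    unfolding graft_def lengths by (cases "i = 0") (auto simp: map_idI)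
qed

subsection \<open>Enumeration\<close>

definition dumont_class :: "nat \<Rightarrow> nat \<Rightarrow> nat list set" where
  "dumont_class r n = {\<pi> \<in> perms n. dumont \<pi> \<and> restricted r \<pi>}"

lemma dumont_class_permsD: "\<pi> \<in> dumont_class r n \<Longrightarrow> \<pi> \<in> perms n"
  by (simp add: dumont_class_def)

lemma dumont_class_0_right [simp]: "dumont_class r 0 = {[]}"
  by (auto simp: dumont_class_def)

lemma dumont_class_0_eq_empty:
  assumes "0 < n"
  shows "dumont_class 0 n = {}"
  using assms by (auto simp: dumont_class_def restricted_0_iff dest: permsD(1))

lemma dumont_class_1_eq_empty:
  assumes "2 \<le> n"
  shows "dumont_class 1 n = {}"
proof -
  have "n \<le> 1" if "\<pi> \<in> dumont_class 1 n" for \<pi>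
    using that restricted_1_length_le[of \<pi>] permsD[of \<pi> n] by (simp add: dumont_class_def)
  then show ?thesis using assms by force
qed

lemma graft_in_dumont_class_odd_iff:
  assumes "\<alpha> \<in> perms i" "\<beta> \<in> perms j" "even (i + j)"
  shows "graft \<alpha> \<beta> \<in> dumont_class (Suc r) (Suc (i + j)) \<longleftrightarrow> j = 0 \<and> \<alpha> \<in> dumont_class r i"
proof (cases "j = 0")
  case True
  then show ?thesis
    using assms graft_in_perms[OF assms(1,2)] dumont_graft_iff[OF assms(1,2)]
      restricted_graft_Nil_iff[OF assms(1)]
    by (simp add: dumont_class_def)
next
  case False
  then show ?thesis using assms dumont_graft_iff[OF assms(1,2)] by (simp add: dumont_class_def)
qed

lemma graft_in_dumont_class_even_iff:
  assumes "\<alpha> \<in> perms i" "\<beta> \<in> perms j" "odd (i + j)"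
  shows "graft \<alpha> \<beta> \<in> dumont_class (Suc (Suc r)) (Suc (i + j)) \<longleftrightarrow>
    (i = 0 \<or> even j \<and> 0 < j) \<and> \<alpha> \<in> dumont_class (Suc r) i \<and> \<beta> \<in> dumont_class (Suc (Suc r)) j"
  using assms graft_in_perms[OF assms(1,2)] dumont_graft_iff[OF assms(1,2)]
    restricted_graft_iff[OF assms(1,2)]
  by (auto simp: dumont_class_def)

lemma card_dumont_class_Suc:
  "card (dumont_class r (Suc m)) =
    (\<Sum>j\<le>m. card {(\<alpha>, \<beta>) \<in> perms (m - j) \<times> perms j. graft \<alpha> \<beta> \<in> dumont_class r (Suc m)})"
  by (rule card_eq_sum_grafts) (auto simp: dumont_class_def restricted_def)

lemma card_dumont_class_odd:
  assumes "even n"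
  shows "card (dumont_class (Suc r) (Suc n)) = card (dumont_class r n)"
proof -
  have "{(\<alpha>, \<beta>) \<in> perms i \<times> perms j. graft \<alpha> \<beta> \<in> dumont_class (Suc r) (Suc n)} =
      (if j = 0 then dumont_class r i \<times> perms j else {})" if "i + j = n" for i j
    using graft_in_dumont_class_odd_iff[of _ i _ j r] assms that
    by (auto simp del: perms_0 dest: dumont_class_permsD)
  then have "card (dumont_class (Suc r) (Suc n)) =
      (\<Sum>j\<le>n. if j = 0 then card (dumont_class r n) else 0)"
    unfolding card_dumont_class_Suc[of "Suc r" n]
    by (intro sum.cong) (auto simp: card_cartesian_product)
  then show ?thesis by simp
qed

lemma card_dumont_class_even:
  "card (dumont_class (Suc (Suc r)) (2 * Suc m)) = card (dumont_class (Suc r) (2 * m)) +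
    (\<Sum>i=1..m. card (dumont_class (Suc (Suc r)) (2 * i)) * card (dumont_class r (2 * (m - i))))"
proof -
  let ?n = "Suc (2 * m)" and ?a = "\<lambda>r n. card (dumont_class r n)"
  define num_grafts where "num_grafts j = card {(\<alpha>, \<beta>) \<in> perms (?n - j) \<times> perms j.
    graft \<alpha> \<beta> \<in> dumont_class (Suc (Suc r)) (Suc ?n)}" for j
  have "{(\<alpha>, \<beta>) \<in> perms i \<times> perms j. graft \<alpha> \<beta> \<in> dumont_class (Suc (Suc r)) (Suc ?n)} =
      (if i = 0 \<or> even j \<and> 0 < j
       then dumont_class (Suc r) i \<times> dumont_class (Suc (Suc r)) j else {})" if "i + j = ?n" for i j
    using graft_in_dumont_class_even_iff[of _ i _ j r] that
    by (auto simp del: perms_0 dumont_class_0_right dest: dumont_class_permsD)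
  then have "num_grafts j = (if j = ?n \<or> even j \<and> 0 < j
      then ?a (Suc r) (?n - j) * ?a (Suc (Suc r)) j else 0)" if "j \<le> ?n" for j
    using that by (auto simp: num_grafts_def card_cartesian_product)
  then have num_grafts_even: "num_grafts (2 * i) =
      (if i = 0 then 0 else ?a (Suc (Suc r)) (2 * i) * ?a r (2 * (m - i)))"
    and num_grafts_odd: "num_grafts (Suc (2 * i)) = (if i = m then ?a (Suc r) (2 * m) else 0)"
    if "i \<le> m" for i
    using that card_dumont_class_odd[of "2 * (m - i)" r] card_dumont_class_odd[of "2 * m" "Suc r"]
    by (auto simp: Suc_diff_le right_diff_distrib')
  have "?a (Suc (Suc r)) (Suc ?n) = (\<Sum>j\<le>?n. num_grafts j)"
    unfolding num_grafts_def by (rule card_dumont_class_Suc)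
  also have "\<dots> = (\<Sum>i\<le>m. num_grafts (2 * i)) + (\<Sum>i\<le>m. num_grafts (Suc (2 * i)))"
    by (simp only: sum.in_pairs_0 sum.distrib)
  also have "(\<Sum>i\<le>m. num_grafts (Suc (2 * i))) = ?a (Suc r) (2 * m)"
    by (simp add: num_grafts_odd)
  also have "(\<Sum>i\<le>m. num_grafts (2 * i)) =
      (\<Sum>i=1..m. ?a (Suc (Suc r)) (2 * i) * ?a r (2 * (m - i)))"
    by (rule sum.mono_neutral_cong_right) (auto simp: num_grafts_even)
  finally show ?thesis by (simp add: add.commute)
qed

unbundle fps_syntax

definition even_dumont_fps :: "nat \<Rightarrow> rat fps" where
  "even_dumont_fps r = Abs_fps (\<lambda>m. of_nat (card (dumont_class r (2 * m))))"

lemma even_dumont_fps_0: "even_dumont_fps 0 = 1"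
  by (rule fps_ext) (simp add: even_dumont_fps_def dumont_class_0_eq_empty)

lemma even_dumont_fps_1: "even_dumont_fps (Suc 0) = 1"
  using dumont_class_1_eq_empty by (intro fps_ext) (simp add: even_dumont_fps_def)

lemma even_dumont_fps_rec:
  "even_dumont_fps (Suc (Suc r)) = 1 + fps_X * even_dumont_fps (Suc r)
     + fps_X * ((even_dumont_fps (Suc (Suc r)) - 1) * even_dumont_fps r)" (is "?E = ?R")
proof (rule fps_ext)
  fix n
  show "?E $ n = ?R $ n"
  proof (cases n)
    case 0
    then show ?thesis by (simp add: even_dumont_fps_def)
  next
    case (Suc m)
    have "((?E - 1) * even_dumont_fps r) $ m =
        (\<Sum>i=1..m. of_nat (card (dumont_class (Suc (Suc r)) (2 * i)) *
          card (dumont_class r (2 * (m - i)))))"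
      unfolding fps_mult_nth
      by (rule sum.mono_neutral_cong_right) (auto simp: even_dumont_fps_def)
    then show ?thesis
      unfolding Suc using card_dumont_class_even[of r m]
      by (simp add: even_dumont_fps_def)
  qed
qed

lemma G_eq_compose: "G r = even_dumont_fps r oo fps_X ^ 2"
proof (induction r rule: G.induct)
  case (3 r)
  let ?E = "even_dumont_fps (Suc (Suc r)) oo fps_X ^ 2 :: rat fps"
  let ?D = "1 - fps_X ^ 2 * G r"
  have "?E = 1 + fps_X ^ 2 * G (Suc r) + fps_X ^ 2 * ((?E - 1) * G r)"
    unfolding 3
    by (subst even_dumont_fps_rec)
      (simp add: fps_compose_add_distrib fps_compose_sub_distrib fps_compose_mult_distrib)
  then have "(?E - 1) * ?D = fps_X ^ 2 * G (Suc r)" by (simp add: algebra_simps)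
  moreover have "?D $ 0 \<noteq> 0" by (simp add: fps_X_power_mult_nth)
  then have "?D \<noteq> 0" by (metis fps_zero_nth)
  ultimately have "?E - 1 = fps_X ^ 2 * G (Suc r) / ?D" by (metis nonzero_mult_div_cancel_right)
  then show ?case by (simp add: algebra_simps)
qed (simp_all add: even_dumont_fps_0 even_dumont_fps_1)

lemma G_nth: "G r $ n = (if even n then of_nat (card (dumont_class r n)) else 0)"
  by (auto simp: G_eq_compose fps_nth_compose_X_power even_dumont_fps_def)

lemma dumont_class_eq:
  assumes "k \<ge> 2"
  shows "dumont_class (k - 1) n = {\<pi> \<in> permutations_of_set {1..n}. dumont \<pi> \<and>
    avoids \<pi> [1, 3, 2] \<and> avoids \<pi> [1..<k+1] \<and> avoids \<pi> ([2, 1] @ [3..<k+1])}"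
proof -
  have "k - 1 + 2 = k + 1" using assms by simp
  then show ?thesis by (simp only: dumont_class_def perms_def restricted_def)
qed

theorem theorem4p2:
  fixes k :: nat
  assumes "k \<ge> 2"
  shows "Abs_fps (\<lambda>n. of_nat (card {\<pi> \<in> permutations_of_set {1..n}. dumont \<pi> \<and>
           avoids \<pi> [1, 3, 2] \<and> avoids \<pi> [1..<k+1] \<and> avoids \<pi> ([2, 1] @ [3..<k+1])}))
         = G (k - 1) + fps_X * G (k - 2)"
proof -
  have k: "k - 1 = Suc (k - 2)" using assms by simp
  have "of_nat (card (dumont_class (k - 1) n)) = (G (k - 1) + fps_X * G (k - 2)) $ n" for n
  proof (cases "even n")
    case True
    then show ?thesis by (cases n) (simp_all add: G_nth)
  next
    case False
    then obtain m where "n = Suc m" "even m" by (cases n) auto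
    then show ?thesis unfolding k by (simp add: G_nth card_dumont_class_odd)
  qed
  then show ?thesis
    by (intro fps_ext) (simp only: fps_nth_Abs_fps dumont_class_eq[OF assms])
qed

end
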